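(* For any $\lambda\in\mathbb{C}$, if $Q_\lambda$ is discrete, then $\lambda$ is an algebraic integer.
   Context: For $\lambda\in\mathbb{C}$, a set $S\subseteq\mathbb{C}$ is $\lambda$-convex if for all $a,b\in S$ the point $(1-\lambda)a+\lambda b$ is in $S$. $Q_\lambda$ denotes the smallest (with respect to $\subseteq$) $\lambda$-convex set containing $\{0,1\}$. Discreteness refers to the topology induced from the usual topology of $\mathbb{C}$. *)

theory Defs
  imports "HOL-Analysis.Analysis" "HOL-Computational_Algebra.Polynomial"
begin

definition lambda_convex :: "complex \<Rightarrow> complex set \<Rightarrow> bool" where
  "lambda_convex l S \<longleftrightarrow> (\<forall>a\<in>S. \<forall>b\<in>S. (1 - l) * a + l * b \<in> S)"

definition Q :: "complex \<Rightarrow> complex set" where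
  "Q l = lambda_convex l hull {0, 1}"

text \<open>The intersection taken by \<^const>\<open>hull\<close> is itself \<open>\<lambda>\<close>-convex, so it is the smallest
  such set containing 0 and 1.\<close>

lemma lambda_convex_Q: "lambda_convex l (Q l)"
  unfolding Q_def by (rule hull_in) (auto simp: lambda_convex_def)

lemma zero_one_subset_Q: "{0, 1} \<subseteq> Q l"
  unfolding Q_def by (rule hull_subset)

lemma Q_minimal: "\<lbrakk>lambda_convex l S; {0, 1} \<subseteq> S\<rbrakk> \<Longrightarrow> Q l \<subseteq> S"
  unfolding Q_def by (rule hull_minimal)

end

theory Submission
  imports Defs
begin

text \<open>Put \<open>\<omega> = l (1 - l)\<close>. For \<open>a, b \<in> Q l\<close> both \<open>\<omega> (a + b)\<close> and \<open>\<omega> + \<omega> (a - b)\<close> lie in \<open>Q l\<close>.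
  Hence multiplication by \<open>\<omega>\<close> halves the number of summands in a sum of differences of elements of
  \<open>Q l\<close>, and as soon as the point \<open>\<omega>\<close> is isolated in \<open>Q l\<close>, the sums of a fixed number of
  differences form a uniformly discrete set. Now iterate \<open>x \<mapsto> -\<omega> x + a + b l\<close> from \<open>x = 1\<close>,
  choosing the integers \<open>a, b\<close> from a finite set so that \<open>x\<close> stays bounded. The halving keeps all
  iterates in one such uniformly discrete set, so two of them coincide. As the \<open>n\<close>-th iterate is
  a monic integer polynomial of degree \<open>2 n\<close> in \<open>l\<close>, their difference gives a monic integer
  equation for \<open>l\<close>.\<close>

section \<open>Closure properties of \<open>Q l\<close>\<close>

lemma Q_conv: "a \<in> Q l \<Longrightarrow> b \<in> Q l \<Longrightarrow> (1 - l) * a + l * b \<in> Q l"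
  using lambda_convex_Q by (auto simp: lambda_convex_def)

lemma zero_in_Q: "0 \<in> Q l" and one_in_Q: "1 \<in> Q l"
  using zero_one_subset_Q by auto

lemma l_in_Q: "l \<in> Q l"
  using Q_conv[OF zero_in_Q one_in_Q] by simp

text \<open>The reflection \<open>a \<mapsto> 1 - a\<close> preserves \<open>l\<close>-convexity and
  swaps 0 and 1, so minimality of \<open>Q l\<close> applies.\<close>

lemma Q_compl:
  assumes "a \<in> Q l"
  shows "1 - a \<in> Q l"
proof -
  have "lambda_convex l {a. 1 - a \<in> Q l}"
    unfolding lambda_convex_def
  proof clarify
    fix a b assume "1 - a \<in> Q l" "1 - b \<in> Q l"
    from Q_conv[OF this] show "1 - ((1 - l) * a + l * b) \<in> Q l"
      by (simp add: algebra_simps)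
  qed
  from Q_minimal[OF this] assms show ?thesis
    by (auto simp: zero_in_Q one_in_Q)
qed

text \<open>Combining \<open>0, a\<close> gives \<open>l * a\<close> and combining
  \<open>b, 0\<close> gives \<open>(1 - l) * b\<close>; combining these two equalizes the
  coefficients.\<close>

lemma Q_scaled_add:
  assumes "a \<in> Q l" "b \<in> Q l"
  shows "l * (1 - l) * (a + b) \<in> Q l"
proof -
  have "l * a \<in> Q l" "(1 - l) * b \<in> Q l"
    using Q_conv[OF zero_in_Q assms(1)] Q_conv[OF assms(2) zero_in_Q] by simp_all
  from Q_conv[OF this] show ?thesis
    by (simp add: algebra_simps)
qed

section \<open>Sums of differences and their discreteness\<close>

text \<open>Level \<open>k\<close> holds the sums of \<open>2 ^ k\<close> differences. Counting by
  doubling makes one multiplication by \<open>l * (1 - l)\<close> cost exactly one level.\<close>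

fun Q_diff :: "complex \<Rightarrow> nat \<Rightarrow> complex set" where
  "Q_diff l 0 = {a - b | a b. a \<in> Q l \<and> b \<in> Q l}"
| "Q_diff l (Suc k) = {u + v | u v. u \<in> Q_diff l k \<and> v \<in> Q_diff l k}"

lemma Q_diff_add: "u \<in> Q_diff l k \<Longrightarrow> v \<in> Q_diff l k \<Longrightarrow> u + v \<in> Q_diff l (Suc k)"
  by auto

lemma Q_subset_Q_diff: "Q l \<subseteq> Q_diff l 0"
proof
  fix a assume "a \<in> Q l"
  moreover have "a = a - 0" by simp
  ultimately show "a \<in> Q_diff l 0"
    using zero_in_Q unfolding Q_diff.simps by blast
qed

lemma Q_diff_uminus: "z \<in> Q_diff l k \<Longrightarrow> - z \<in> Q_diff l k"
proof (induction k arbitrary: z)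
  case 0
  then show ?case by (auto intro: minus_diff_eq)
next
  case (Suc k)
  then obtain u v where "z = u + v" "u \<in> Q_diff l k" "v \<in> Q_diff l k"
    by auto
  with Suc.IH Q_diff_add[of "- u" l k "- v"] show ?case
    by simp
qed

lemma zero_in_Q_diff: "0 \<in> Q_diff l k"
proof (induction k)
  case 0
  then show ?case using Q_subset_Q_diff zero_in_Q by blast
next
  case (Suc k)
  from Q_diff_add[OF this this] show ?case by simp
qed

lemma Q_diff_mono:
  assumes "j \<le> k"
  shows "Q_diff l j \<subseteq> Q_diff l k"
  using assms
proof (induction k rule: dec_induct)
  case (step k)
  have "z \<in> Q_diff l (Suc k)" if "z \<in> Q_diff l k" for z
    using Q_diff_add[OF that zero_in_Q_diff] by simp
  with step show ?case by blast
qed simp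

lemma Q_diff_scaled: "z \<in> Q_diff l (Suc k) \<Longrightarrow> l * (1 - l) * z \<in> Q_diff l k"
proof (induction k arbitrary: z)
  case 0
  then obtain a b c d where "z = (a - b) + (c - d)"
    and Q: "a \<in> Q l" "b \<in> Q l" "c \<in> Q l" "d \<in> Q l"
    by auto
  then have z: "z = (a + c) - (b + d)" by simp
  from Q have "l * (1 - l) * (a + c) \<in> Q l" "l * (1 - l) * (b + d) \<in> Q l"
    using Q_scaled_add by blast+
  then show ?case
    unfolding z right_diff_distrib by auto
next
  case (Suc k)
  then obtain u v where "z = u + v" "u \<in> Q_diff l (Suc k)" "v \<in> Q_diff l (Suc k)"
    by auto
  with Suc.IH Q_diff_add[of "l * (1 - l) * u" l k "l * (1 - l) * v"] show ?case
    by (simp only: distrib_left)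
qed

lemma Q_diff_scaled_power: "z \<in> Q_diff l k \<Longrightarrow> (l * (1 - l)) ^ k * z \<in> Q_diff l 0"
proof (induction k arbitrary: z)
  case (Suc k)
  from Suc.IH[OF Q_diff_scaled[OF Suc.prems]] show ?case
    by (simp only: power_Suc ac_simps)
qed simp

lemma Q_diff_separated:
  assumes "discrete (Q l)" "l \<noteq> 0" "l \<noteq> 1"
  obtains e where "e > 0" "\<And>z. z \<in> Q_diff l k \<Longrightarrow> cmod z < e \<Longrightarrow> z = 0"
proof -
  define w where "w = l * (1 - l)"
  have w0: "w \<noteq> 0" using assms by (simp add: w_def)
  have "w \<in> Q l"
    using Q_scaled_add[OF one_in_Q zero_in_Q] by (simp add: w_def)
  with assms(1) obtain d where d: "d > 0" "\<And>y. y \<in> Q l \<Longrightarrow> dist w y < d \<Longrightarrow> y = w"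
    unfolding discrete_def isolated_in_dist_Ex_iff by (metis dist_commute)
  show ?thesis
  proof (rule that)
    \<comment> \<open>Here \<open>k\<close> factors \<open>w\<close> reduce \<open>z\<close> to a
      single difference \<open>a - b\<close>; one more turns it into the point
      \<open>w * (a + (1 - b))\<close> of \<open>Q l\<close>, which is close to
      \<open>w\<close>.\<close>
    show "d / cmod w ^ Suc k > 0" using d(1) w0 by simp
    fix z assume z: "z \<in> Q_diff l k" and small: "cmod z < d / cmod w ^ Suc k"
    from Q_diff_scaled_power[OF z] obtain a b
      where ab: "a \<in> Q l" "b \<in> Q l" "w ^ k * z = a - b"
      by (auto simp: w_def)
    have "w * (a + (1 - b)) = w + w * (w ^ k * z)"
      unfolding ab(3) by (simp add: algebra_simps)
    then have "w + w ^ Suc k * z \<in> Q l"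
      using Q_scaled_add[OF ab(1) Q_compl[OF ab(2)]] by (simp add: w_def mult.assoc)
    moreover have "dist w (w + w ^ Suc k * z) < d"
      using small w0 by (simp add: dist_norm norm_mult norm_power field_simps)
    ultimately have "w + w ^ Suc k * z = w" by (rule d(2))
    with w0 show "z = 0" by simp
  qed
qed

text \<open>Differences of two points of level \<open>k\<close> lie in level \<open>Suc k\<close>,
  so separation from 0 there spaces out level \<open>k\<close> uniformly.\<close>

lemma finite_Q_diff_cball:
  assumes "discrete (Q l)" "l \<noteq> 0" "l \<noteq> 1"
  shows "finite (Q_diff l k \<inter> cball 0 R)"
proof -
  obtain e where e: "e > 0" "\<And>z. z \<in> Q_diff l (Suc k) \<Longrightarrow> cmod z < e \<Longrightarrow> z = 0"
    using Q_diff_separated[OF assms] by metis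
  have "x = y" if "x \<in> Q_diff l k" "y \<in> Q_diff l k" "dist x y < e" for x y
    using e(2)[OF Q_diff_add[OF that(1) Q_diff_uminus[OF that(2)]]] that(3)
    by (simp add: dist_norm)
  with e(1) have "uniform_discrete (Q_diff l k \<inter> cball 0 R)"
    unfolding uniform_discrete_def by blast
  then show ?thesis
    by (simp add: uniform_discrete_finite_iff[symmetric] bounded_Int)
qed

section \<open>Approximation by integer combinations of 1 and \<open>l\<close>\<close>

text \<open>The union of all levels is an additive group containing 1 and \<open>l\<close>.\<close>

lemma lattice_in_Q_diff: "\<exists>k. of_int a + of_int b * l \<in> Q_diff l k"
proof -
  define G where "G = (\<Union>k. Q_diff l k)"
  have add: "u + v \<in> G" if "u \<in> G" "v \<in> G" for u v
  proof -
    from that obtain i j where "u \<in> Q_diff l i" "v \<in> Q_diff l j"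
      by (auto simp: G_def)
    then have "u \<in> Q_diff l (max i j)" "v \<in> Q_diff l (max i j)"
      using Q_diff_mono[of i "max i j" l] Q_diff_mono[of j "max i j" l] by auto
    from Q_diff_add[OF this] show ?thesis
      unfolding G_def by blast
  qed
  have nat: "of_nat n * u \<in> G" if "u \<in> G" for n u
  proof (induction n)
    case 0
    show ?case using zero_in_Q_diff[of l 0] unfolding G_def by (auto simp del: Q_diff.simps)
  next
    case (Suc n)
    from add[OF that this] show ?case by (simp add: algebra_simps)
  qed
  have int: "of_int c * u \<in> G" if "u \<in> G" for c u
  proof (cases c)
    case (nonneg n)
    then show ?thesis using nat[OF that] by simp
  next
    case (neg n)
    then have "of_int c * u = - (of_nat (Suc n) * u)"
      by (simp only: of_int_minus of_int_of_nat_eq mult_minus_left)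
    then show ?thesis using nat[OF that, of "Suc n"] Q_diff_uminus
      unfolding G_def by fastforce
  qed
  have "1 \<in> G" "l \<in> G"
    using Q_subset_Q_diff[of l] one_in_Q[of l] l_in_Q[of l] unfolding G_def by blast+
  from add[OF int[OF this(1), of a] int[OF this(2), of b]] show ?thesis
    by (simp add: G_def)
qed

text \<open>If \<open>l\<close> is real, then \<open>\<int> + \<int>l\<close> only approximates real numbers, whence the condition
  on imaginary parts.\<close>

lemma lattice_close:
  fixes l z :: complex
  assumes "Im l = 0 \<Longrightarrow> Im z = 0"
  shows "\<exists>a b :: int. cmod (z - (of_int a + of_int b * l)) \<le> 1 + cmod l"
proof -
  \<comment> \<open>\<open>t\<close> and \<open>s\<close> are the real coordinates of
    \<open>z\<close> with respect to 1 and \<open>l\<close>; rounding them down gives the lattice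
    point.\<close>
  define s where "s = (if Im l = 0 then 0 else Im z / Im l)"
  define t where "t = Re z - s * Re l"
  have "z - (of_int \<lfloor>t\<rfloor> + of_int \<lfloor>s\<rfloor> * l) = of_real (frac t) + of_real (frac s) * l"
    using assms by (auto simp: complex_eq_iff s_def t_def frac_def algebra_simps)
  also have "cmod \<dots> \<le> frac t + frac s * cmod l"
    by (rule norm_triangle_le) (simp add: norm_mult)
  also have "\<dots> \<le> 1 + cmod l"
    using frac_lt_1[of t] frac_lt_1[of s]
    by (intro add_mono mult_left_le_one_le) simp_all
  finally show ?thesis by blast
qed

text \<open>By compactness finitely many lattice points serve all \<open>z\<close> of bounded size,
  so a single level \<open>k\<close> contains them. The bound is \<open>2 + cmod l\<close> because
  the covering balls are open.\<close>

lemma Q_diff_lattice_close: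
  fixes l :: complex
  obtains k where "\<And>z. cmod z \<le> C \<Longrightarrow> (Im l = 0 \<Longrightarrow> Im z = 0) \<Longrightarrow>
    \<exists>a b :: int. of_int a + of_int b * l \<in> Q_diff l k \<and>
      cmod (z + (of_int a + of_int b * l)) \<le> 2 + cmod l"
proof -
  define f :: "int \<times> int \<Rightarrow> complex" where "f = (\<lambda>(a, b). of_int a + of_int b * l)"
  define S where "S = cball 0 C \<inter> {z. Im l = 0 \<longrightarrow> Im z = 0}"
  have "compact S"
    unfolding S_def by (cases "Im l = 0") (auto intro!: compact_Int_closed closed_Collect_eq continuous_intros)
  moreover have "S \<subseteq> (\<Union>p\<in>UNIV. ball (f p) (2 + cmod l))"
  proof
    fix z assume "z \<in> S"
    then obtain a b where "cmod (z - (of_int a + of_int b * l)) \<le> 1 + cmod l"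
      using lattice_close[of l z] by (auto simp: S_def)
    then have "z \<in> ball (f (a, b)) (2 + cmod l)"
      by (simp add: f_def dist_norm norm_minus_commute)
    then show "z \<in> (\<Union>p\<in>UNIV. ball (f p) (2 + cmod l))" by blast
  qed
  ultimately obtain P where P: "finite P" "S \<subseteq> (\<Union>p\<in>P. ball (f p) (2 + cmod l))"
    using compactE_image[of S UNIV "\<lambda>p. ball (f p) (2 + cmod l)"] by auto
  have "\<forall>p. \<exists>k. f p \<in> Q_diff l k"
    using lattice_in_Q_diff by (auto simp: f_def split: prod.split)
  then obtain h where h: "\<And>p. f p \<in> Q_diff l (h p)" by metis
  \<comment> \<open>Inserting 0 keeps \<open>Max\<close> meaningful when \<open>P\<close> is
    empty.\<close>
  define k where "k = Max (insert 0 (h ` P))"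
  have k: "f p \<in> Q_diff l k" if "p \<in> P" for p
    using that h[of p] Q_diff_mono[of "h p" k l] P(1) unfolding k_def by auto
  show ?thesis
  proof (rule that)
    fix z assume "cmod z \<le> C" "Im l = 0 \<Longrightarrow> Im z = 0"
    then have "z \<in> S" by (auto simp: S_def)
    with P(2) obtain a b where ab: "(a, b) \<in> P" "z \<in> ball (f (a, b)) (2 + cmod l)"
      by auto
    have eq: "of_int (- a) + of_int (- b) * l = - f (a, b)"
      by (simp add: f_def)
    have "cmod (z + - f (a, b)) \<le> 2 + cmod l"
      using ab(2) by (simp add: dist_norm norm_minus_commute)
    with eq k[OF ab(1)] Q_diff_uminus show "\<exists>a b :: int. of_int a + of_int b * l \<in> Q_diff l k \<and>
      cmod (z + (of_int a + of_int b * l)) \<le> 2 + cmod l"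
      by metis
  qed
qed

section \<open>Monic integer polynomials with bounded values at \<open>l\<close>\<close>

lemma monic_values_bounded:
  fixes l :: complex
  obtains k R where "\<And>n. \<exists>p. degree p = 2 * n \<and> lead_coeff p = 1 \<and> (\<forall>i. coeff p i \<in> \<int>) \<and>
    poly p l \<in> Q_diff l k \<inter> cball 0 R"
proof -
  define R where "R = 2 + cmod l"
  obtain k where k: "\<And>z. cmod z \<le> cmod (l * (1 - l)) * R \<Longrightarrow> (Im l = 0 \<Longrightarrow> Im z = 0) \<Longrightarrow>
    \<exists>a b :: int. of_int a + of_int b * l \<in> Q_diff l k \<and> cmod (z + (of_int a + of_int b * l)) \<le> R"
    using Q_diff_lattice_close unfolding R_def by metis
  \<comment> \<open>The level is stable: scaling lowers \<open>Suc k\<close> to \<open>k\<close>,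
    and adding a lattice point of level \<open>k\<close> restores \<open>Suc k\<close>. Realness for
    real \<open>l\<close> is carried along to keep the approximation applicable.\<close>
  have "\<exists>p. degree p = 2 * n \<and> lead_coeff p = 1 \<and> (\<forall>i. coeff p i \<in> \<int>) \<and>
    poly p l \<in> Q_diff l (Suc k) \<and> cmod (poly p l) \<le> R \<and> (Im l = 0 \<longrightarrow> Im (poly p l) = 0)" for n
  proof (induction n)
    case 0
    have "1 \<in> Q_diff l (Suc k)"
      using one_in_Q Q_subset_Q_diff Q_diff_mono[of 0 "Suc k"] by blast
    then show ?case
      by (intro exI[of _ 1]) (simp add: R_def del: Q_diff.simps)
  next
    case (Suc n)
    then obtain p where p: "degree p = 2 * n" "lead_coeff p = 1" "\<And>i. coeff p i \<in> \<int>"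
      "poly p l \<in> Q_diff l (Suc k)" "cmod (poly p l) \<le> R" "Im l = 0 \<Longrightarrow> Im (poly p l) = 0"
      by blast
    define z where "z = - (l * (1 - l) * poly p l)"
    have "cmod z \<le> cmod (l * (1 - l)) * R"
      using p(5) by (simp add: z_def norm_mult mult_left_mono)
    moreover have Imz: "Im z = 0" if "Im l = 0"
      using p(6)[OF that] that by (simp add: z_def)
    ultimately obtain a b :: int where ab: "of_int a + of_int b * l \<in> Q_diff l k"
      "cmod (z + (of_int a + of_int b * l)) \<le> R"
      using k by blast
    \<comment> \<open>The factor is \<open>X^2 - X\<close>, with value
      \<open>- (l * (1 - l))\<close> at \<open>l\<close>; this sign keeps the polynomials
      monic.\<close>
    define q where "q = [:0, -1, 1:] * p + [:of_int a, of_int b:]"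
    have vq: "poly q l = z + (of_int a + of_int b * l)"
      by (simp add: q_def z_def algebra_simps)
    have p0: "p \<noteq> 0" using p(2) by auto
    have deg: "degree ([:0, -1, 1:] * p) = 2 * Suc n"
      using p0 p(1) by (subst degree_mult_eq) auto
    have small: "degree [:of_int a, of_int b :: complex:] < 2 * Suc n"
      by (rule le_less_trans[OF degree_pCons_le]) simp
    have degq: "degree q = 2 * Suc n"
      unfolding q_def using deg small by (subst degree_add_eq_left) auto
    moreover have "lead_coeff q = 1"
      using degq deg small p(2) lead_coeff_mult[of "[:0, -1, 1:]" p]
      by (simp add: q_def coeff_eq_0)
    moreover have "\<forall>i. coeff q i \<in> \<int>"
      using p(3) unfolding q_def coeff_add coeff_mult
      by (auto intro!: Ints_add Ints_sum Ints_mult simp: coeff_pCons split: nat.split)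
    moreover have "poly q l \<in> Q_diff l (Suc k)"
      unfolding vq z_def using Q_diff_add[OF Q_diff_uminus[OF Q_diff_scaled[OF p(4)]] ab(1)] .
    moreover have "Im l = 0 \<longrightarrow> Im (poly q l) = 0"
      using Imz by (simp add: vq)
    ultimately show ?case using ab(2) vq by metis
  qed
  then show ?thesis
    by (intro that[of "Suc k" R]) (simp del: Q_diff.simps, blast)
qed

theorem theorem8p2:
  fixes l :: complex
  assumes "discrete (Q l)"
  shows "algebraic_int l"
proof (cases "l = 0 \<or> l = 1")
  case True
  then show ?thesis by auto
next
  case False
  obtain k R where "\<And>n. \<exists>p. degree p = 2 * n \<and> lead_coeff p = 1 \<and> (\<forall>i. coeff p i \<in> \<int>) \<and>
    poly p l \<in> Q_diff l k \<inter> cball 0 R"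
    using monic_values_bounded by blast
  then obtain p where p: "\<And>n. degree (p n) = 2 * n" "\<And>n. lead_coeff (p n) = 1"
    "\<And>n i. coeff (p n) i \<in> \<int>" "\<And>n. poly (p n) l \<in> Q_diff l k \<inter> cball 0 R"
    by metis
  have "finite (range (\<lambda>n. poly (p n) l))"
    by (rule finite_subset[OF _ finite_Q_diff_cball[of l k R]]) (use p(4) False assms in auto)
  then have "\<not> inj (\<lambda>n. poly (p n) l)"
    using finite_imageD infinite_UNIV_nat by blast
  then obtain m n where mn: "m < n" "poly (p m) l = poly (p n) l"
    unfolding inj_def by (metis linorder_neqE_nat)
  \<comment> \<open>Since the degrees differ, subtracting leaves the leading coefficient 1 of
    \<open>p n\<close> intact.\<close>
  have less: "degree (p m) < degree (p n)"
    using mn(1) by (simp add: p(1))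
  then have "degree (p n - p m) = degree (p n)"
    using degree_add_eq_left[of "- p m" "p n"] by simp
  then have "lead_coeff (p n - p m) = 1"
    using p(2)[of n] less by (simp add: coeff_eq_0)
  moreover have "\<forall>i. coeff (p n - p m) i \<in> \<int>"
    using p(3) by simp
  moreover have "poly (p n - p m) l = 0"
    using mn(2) by simp
  ultimately show ?thesis
    by (rule algebraic_int.intros)
qed

end
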